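(* A valid core inequality $\beta_0+\sum_{j=1}^n\beta_jx_j+\beta' y\ge 0$ is a core facet only if it is satisfied exactly at $(x^k,m(x^k))$ for at least two of the extreme points $x^k$, $k\in\{0,\dots,n\}$, of the simplex $\mathcal{S}$, with at least one of these extreme points not being $x^0$ or $x^n$.
   Context: Let $n\ge 2$, $N=\{1,\dots,n\}$, and let $\ell<u$ be real numbers. Let $X=\{x\in\mathbb{R}^n:\ell\le x_j\le u,\ j\in N\}$. For real coefficients $c_2,\dots,c_n$, not all zero, let $m(x)=\sum_{i=2}^n c_i\sum_{J\subseteq N,\ |J|=i}\prod_{j\in J}x_j$, and let $G=\{(x,y)\in\mathbb{R}^n\times\mathbb{R}: x\in X,\ y=m(x)\}$. The set $\operatorname{conv}(G)$ is a polytope of dimension $n+1$. Let $\mathcal{S}=\{x\in\mathbb{R}^n:u\ge x_1\ge\cdots\ge x_n\ge\ell\}$, whose extreme points are $x^k$, $k=0,\dots,n$, where $x^k$ has its first $k$ entries equal to $u$ and its last $n-k$ entries equal to $\ell$. A core inequality is a linear inequality $\beta_0+\sum_{j=1}^n\beta_jx_j+\beta' y\ge 0$ with $\beta'\in\{-1,1\}$ and $\beta_1\le\cdots\le\beta_n$; it is a valid core inequality if it is satisfied by all points of $\operatorname{conv}(G)$; it is a core facet if it is valid and the set of points of $\operatorname{conv}(G)$ satisfying it with equality is a facet of $\operatorname{conv}(G)$. "Satisfied exactly" means satisfied with equality. *)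

theory Defs
  imports "HOL-Analysis.Analysis"
begin

text \<open>
  The index set \<open>N = {1,\<dots>,n}\<close> with its order is rendered by a finite linearly ordered type
  \<open>'n\<close>, with \<open>n = CARD('n)\<close>. The coefficients are a function \<open>c :: nat \<Rightarrow> real\<close> of
  which only the values at \<open>2,\<dots>,n\<close> are used.
\<close>

definition box_X :: "real \<Rightarrow> real \<Rightarrow> (real ^ 'n) set" where
  "box_X l u = {x. \<forall>j. l \<le> x $ j \<and> x $ j \<le> u}"

definition sym_multilinear :: "(nat \<Rightarrow> real) \<Rightarrow> real ^ 'n \<Rightarrow> real" where
  "sym_multilinear c x =
     (\<Sum>i = 2..CARD('n). c i * (\<Sum>J | J \<subseteq> (UNIV :: 'n set) \<and> card J = i. \<Prod>j\<in>J. x $ j))"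

definition graph_G :: "(nat \<Rightarrow> real) \<Rightarrow> real \<Rightarrow> real \<Rightarrow> ((real ^ 'n) \<times> real) set" where
  "graph_G c l u = {(x, y). x \<in> box_X l u \<and> y = sym_multilinear c x}"

text \<open>
  The vertices of the simplex \<open>u \<ge> x\<^sub>1 \<ge> \<dots> \<ge> x\<^sub>n \<ge> l\<close>. The number of indices below \<open>j\<close> is the
  0-based position of \<open>j\<close>, so exactly the first \<open>k\<close> entries are \<open>u\<close> (for \<open>k \<le> n\<close>).
\<close>

definition simplex_vertex :: "real \<Rightarrow> real \<Rightarrow> nat \<Rightarrow> real ^ 'n::{finite,linorder}" where
  "simplex_vertex l u k = (\<chi> j. if card {i. i < j} < k then u else l)"

definition ineq_lhs :: "real \<Rightarrow> real ^ 'n \<Rightarrow> real \<Rightarrow> (real ^ 'n) \<times> real \<Rightarrow> real" where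
  "ineq_lhs \<beta>0 \<beta> \<beta>' = (\<lambda>(x, y). \<beta>0 + (\<Sum>j\<in>UNIV. \<beta> $ j * x $ j) + \<beta>' * y)"

definition core_inequality :: "real ^ 'n::{finite,linorder} \<Rightarrow> real \<Rightarrow> bool" where
  "core_inequality \<beta> \<beta>' \<longleftrightarrow> \<beta>' \<in> {-1, 1} \<and> mono (\<lambda>j. \<beta> $ j)"

definition valid_core_inequality ::
  "(nat \<Rightarrow> real) \<Rightarrow> real \<Rightarrow> real \<Rightarrow> real \<Rightarrow> real ^ 'n::{finite,linorder} \<Rightarrow> real \<Rightarrow> bool" where
  "valid_core_inequality c l u \<beta>0 \<beta> \<beta>' \<longleftrightarrow>
     core_inequality \<beta> \<beta>' \<and> (\<forall>p \<in> convex hull graph_G c l u. ineq_lhs \<beta>0 \<beta> \<beta>' p \<ge> 0)"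

definition core_facet ::
  "(nat \<Rightarrow> real) \<Rightarrow> real \<Rightarrow> real \<Rightarrow> real \<Rightarrow> real ^ 'n::{finite,linorder} \<Rightarrow> real \<Rightarrow> bool" where
  "core_facet c l u \<beta>0 \<beta> \<beta>' \<longleftrightarrow>
     valid_core_inequality c l u \<beta>0 \<beta> \<beta>' \<and>
     {p \<in> convex hull graph_G c l u. ineq_lhs \<beta>0 \<beta> \<beta>' p = 0} facet_of (convex hull graph_G c l u)"

definition exact_at_vertex ::
  "(nat \<Rightarrow> real) \<Rightarrow> real \<Rightarrow> real \<Rightarrow> real \<Rightarrow> real ^ 'n::{finite,linorder} \<Rightarrow> real \<Rightarrow> nat \<Rightarrow> bool" where
  "exact_at_vertex c l u \<beta>0 \<beta> \<beta>' k \<longleftrightarrow>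
     ineq_lhs \<beta>0 \<beta> \<beta>' (let x = simplex_vertex l u k in (x, sym_multilinear c x)) = 0"

end

theory Submission
  imports Defs "HOL-Computational_Algebra.Polynomial"
begin

text \<open>
  Two facts carry the proof. First, since \<open>m\<close> is affine in each coordinate separately, \<open>conv(G)\<close> is
  the convex hull of the finitely many points \<open>(v, m(v))\<close> with \<open>v \<in> {l,u}\<^sup>n\<close>; hence a facet is the
  convex hull of the points of this kind that it contains, which are called its tight vertices here.
  Second, \<open>m\<close> is symmetric and \<open>\<beta>\<close> is nondecreasing, so among all \<open>v\<close> with exactly \<open>k\<close> entries
  equal to \<open>u\<close> the left-hand side of a core inequality is smallest at the vertex \<open>x\<^sup>k\<close> of the simplex
  (lemma \<open>ineq_lhs_simplex_vertex_le\<close>). By validity, if some \<open>v\<close> with \<open>k\<close> entries \<open>u\<close> is tight,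
  then so is \<open>x\<^sup>k\<close>.

  If the conclusion failed, then either all tight vertices would have one and the same number of
  entries \<open>u\<close>, or every tight vertex would be constant (all \<open>l\<close> or all \<open>u\<close>). In the first case the
  facet lies in a hyperplane \<open>\<Sum>\<^sub>j x\<^sub>j = const\<close>; in the second it lies in \<open>x\<^sub>p - x\<^sub>q = 0\<close> for any two
  indices \<open>p \<noteq> q\<close>. Such a vertical hyperplane, whose normal has no \<open>y\<close>-component, differs from the
  supporting hyperplane because \<open>\<beta>' \<noteq> 0\<close>. So the facet would have dimension at most \<open>n - 1\<close>. This
  is impossible, since \<open>conv(G)\<close> has dimension \<open>n + 1\<close>: the function \<open>m\<close> is not affine on the box,
  as its restriction to the diagonal is a polynomial with a nonzero coefficient of degree at least 2.
\<close>

section \<open>Two-valued points and the simplex vertices\<close>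

definition two_valued :: "real \<Rightarrow> real \<Rightarrow> 'n set \<Rightarrow> real ^ 'n" where
  "two_valued l u A = (\<chi> j. if j \<in> A then u else l)"

definition first_indices :: "nat \<Rightarrow> 'n::{finite,linorder} set" where
  "first_indices k = {j. card {i. i < j} < k}"

lemma simplex_vertex_two_valued: "simplex_vertex l u k = two_valued l u (first_indices k)"
  by (simp add: simplex_vertex_def two_valued_def first_indices_def)

lemma card_below_strict_mono:
  fixes i j :: "'n::{finite,linorder}"
  assumes "i < j"
  shows "card {h. h < i} < card {h. h < j}"
  using assms by (intro psubset_card_mono) auto

text \<open>Counting the smaller elements is a bijection from the index type onto \<open>{..<n}\<close>.\<close>

lemma card_first_indices:
  assumes "k \<le> CARD('n::{finite,linorder})"
  shows "card (first_indices k :: 'n set) = k"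
proof -
  define pos where "pos = (\<lambda>j::'n. card {i. i < j})"
  have inj: "inj pos"
    unfolding pos_def by (intro linorder_injI) (use card_below_strict_mono in force)
  have "range pos \<subseteq> {..<CARD('n)}"
    unfolding pos_def by (auto intro!: psubset_card_mono)
  moreover have "card (range pos) = card {..<CARD('n)}"
    using inj by (simp add: card_image)
  ultimately have "range pos = {..<CARD('n)}"
    by (simp add: card_subset_eq)
  then have "card (pos -` {..<k}) = card {..<k}"
    using assms inj by (intro card_vimage_inj) auto
  moreover have "first_indices k = pos -` {..<k}"
    by (auto simp: first_indices_def pos_def)
  ultimately show ?thesis by simp
qed

text \<open>
  Every index in the initial segment but not in \<open>A\<close> precedes every index of \<open>A\<close> outside the initial
  segment, and there are equally many of both kinds, so exchanging them cannot decrease the sum.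
\<close>

lemma sum_first_indices_le:
  fixes f :: "'n::{finite,linorder} \<Rightarrow> real"
  assumes "mono f"
  shows "sum f (first_indices (card A)) \<le> sum f A"
proof -
  define I where "I = (first_indices (card A) :: 'n set)"
  have card_I: "card I = card A"
    unfolding I_def by (intro card_first_indices card_mono) auto
  then have "card (I - A) = card (A - I)"
    by (simp add: card_Diff_subset_Int Int_commute)
  then obtain h where h: "bij_betw h (I - A) (A - I)"
    using finite_same_card_bij[of "I - A" "A - I"] by auto
  have "f i \<le> f (h i)" if "i \<in> I - A" for i
  proof -
    have "h i \<in> A - I" using h that by (auto simp: bij_betw_def)
    then have "\<not> h i < i"
      using that card_below_strict_mono[of "h i" i] by (auto simp: I_def first_indices_def)
    then show ?thesis using assms by (simp add: monoD)
  qed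
  then have "sum f (I - A) \<le> (\<Sum>i\<in>I - A. f (h i))"
    by (rule sum_mono)
  also have "\<dots> = sum f (A - I)"
    by (rule sum.reindex_bij_betw[OF h])
  finally have "sum f (I - A) \<le> sum f (A - I)" .
  moreover have "sum f I = sum f (I \<inter> A) + sum f (I - A)"
    "sum f A = sum f (A \<inter> I) + sum f (A - I)"
    by (simp_all add: sum.Int_Diff)
  ultimately show ?thesis
    by (simp add: I_def Int_commute)
qed

section \<open>Symmetry and the minimizing simplex vertex\<close>

lemma sym_multilinear_permute:
  fixes x :: "real ^ 'n" and h :: "'n \<Rightarrow> 'n"
  assumes "bij h"
  shows "sym_multilinear c (\<chi> j. x $ h j) = sym_multilinear c x"
proof -
  have "(\<Sum>J | J \<subseteq> (UNIV :: 'n set) \<and> card J = i. \<Prod>j\<in>J. (\<chi> j. x $ h j) $ j)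
      = (\<Sum>J | J \<subseteq> (UNIV :: 'n set) \<and> card J = i. \<Prod>j\<in>J. x $ j)" for i
  proof (rule sum.reindex_bij_witness[where i = "\<lambda>J. inv h ` J" and j = "\<lambda>J. h ` J"])
    fix J
    have inj: "inj_on h J" using assms by (meson bij_is_inj inj_on_subset subset_UNIV)
    then show "(\<Prod>j\<in>h ` J. x $ j) = (\<Prod>j\<in>J. (\<chi> j. x $ h j) $ j)"
      by (simp add: prod.reindex)
  qed (use assms in \<open>auto simp: bij_is_inj bij_is_surj image_f_inv_f card_image
         bij_imp_bij_inv intro!: card_image inj_on_subset[OF bij_is_inj]\<close>)
  then show ?thesis by (simp add: sym_multilinear_def)
qed

lemma sym_multilinear_two_valued_cong:
  fixes A B :: "'n::finite set"
  assumes "card A = card B"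
  shows "sym_multilinear c (two_valued l u A) = sym_multilinear c (two_valued l u B)"
proof -
  obtain f where f: "bij_betw f A B"
    using assms finite_same_card_bij[of A B] by auto
  have "card (- A) = card (- B)" using assms by (simp add: Compl_eq_Diff_UNIV card_Diff_subset)
  then obtain g where g: "bij_betw g (- A) (- B)"
    using finite_same_card_bij[of "- A" "- B"] by auto
  define h where "h = (\<lambda>j. if j \<in> A then f j else g j)"
  have "bij_betw h A B" "bij_betw h (- A) (- B)"
    using f g by (auto simp: h_def bij_betw_def inj_on_def image_def)
  then have "bij_betw h (A \<union> - A) (B \<union> - B)"
    by (rule bij_betw_combine) auto
  then have "bij h" by simp
  moreover have "h j \<in> B \<longleftrightarrow> j \<in> A" for j
    using f g by (auto simp: h_def bij_betw_def)
  then have "two_valued l u A = (\<chi> j. two_valued l u B $ h j)"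
    by (simp add: two_valued_def vec_eq_iff)
  ultimately show ?thesis
    by (simp add: sym_multilinear_permute)
qed

lemma sum_mult_two_valued:
  fixes a :: "real ^ 'n"
  shows "(\<Sum>j\<in>UNIV. a $ j * two_valued l u A $ j) = l * (\<Sum>j\<in>UNIV. a $ j) + (u - l) * (\<Sum>j\<in>A. a $ j)"
proof -
  have "(\<Sum>j\<in>UNIV. a $ j * two_valued l u A $ j)
      = (\<Sum>j\<in>UNIV. l * a $ j + (if j \<in> A then (u - l) * a $ j else 0))"
    by (intro sum.cong) (auto simp: two_valued_def algebra_simps)
  then show ?thesis
    by (simp add: sum.distrib sum_distrib_left sum.If_cases)
qed

lemma ineq_lhs_simplex_vertex_le:
  fixes \<beta> :: "real ^ 'n::{finite,linorder}" and A :: "'n set"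
  assumes "core_inequality \<beta> \<beta>'" and "l < u"
  defines "x \<equiv> \<lambda>A. two_valued l u A"
  shows "ineq_lhs \<beta>0 \<beta> \<beta>' (let v = simplex_vertex l u (card A) in (v, sym_multilinear c v))
       \<le> ineq_lhs \<beta>0 \<beta> \<beta>' (x A, sym_multilinear c (x A))"
proof -
  have "card (first_indices (card A) :: 'n set) = card A"
    by (intro card_first_indices card_mono) auto
  then have "sym_multilinear c (x (first_indices (card A))) = sym_multilinear c (x A)"
    unfolding x_def by (rule sym_multilinear_two_valued_cong)
  moreover have "(\<Sum>j\<in>first_indices (card A). \<beta> $ j) \<le> (\<Sum>j\<in>A. \<beta> $ j)"
    using assms(1) sum_first_indices_le[of "\<lambda>j. \<beta> $ j" A] by (simp add: core_inequality_def)
  then have "(u - l) * (\<Sum>j\<in>first_indices (card A). \<beta> $ j) \<le> (u - l) * (\<Sum>j\<in>A. \<beta> $ j)"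
    using assms(2) by (intro mult_left_mono) auto
  ultimately show ?thesis
    unfolding simplex_vertex_two_valued Let_def ineq_lhs_def prod.case x_def sum_mult_two_valued
    by (simp only: add_le_cancel_left add_le_cancel_right)
qed

section \<open>The convex hull of the graph\<close>

definition cube_graph :: "(nat \<Rightarrow> real) \<Rightarrow> real \<Rightarrow> real \<Rightarrow> ((real ^ 'n) \<times> real) set" where
  "cube_graph c l u = range (\<lambda>A. (two_valued l u A, sym_multilinear c (two_valued l u A)))"

lemma sym_multilinear_affine_coordinate:
  fixes x y :: "real ^ 'n"
  assumes "\<And>i. i \<noteq> j \<Longrightarrow> x $ i = y $ i"
  shows "sym_multilinear c ((1 - t) *\<^sub>R x + t *\<^sub>R y)
       = (1 - t) * sym_multilinear c x + t * sym_multilinear c y"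
proof -
  define z where "z = (1 - t) *\<^sub>R x + t *\<^sub>R y"
  have z_other: "z $ i = x $ i" if "i \<noteq> j" for i
    using assms[OF that] by (simp add: z_def algebra_simps)
  have prod_eq: "(\<Prod>i\<in>J. z $ i) = (1 - t) * (\<Prod>i\<in>J. x $ i) + t * (\<Prod>i\<in>J. y $ i)" for J
  proof (cases "j \<in> J")
    case True
    have "(\<Prod>i\<in>J - {j}. z $ i) = (\<Prod>i\<in>J - {j}. x $ i)"
      "(\<Prod>i\<in>J - {j}. y $ i) = (\<Prod>i\<in>J - {j}. x $ i)"
      using z_other assms by (auto intro!: prod.cong)
    then show ?thesis
      using True by (simp add: prod.remove[of J j] z_def algebra_simps)
  next
    case False
    then have "z $ i = x $ i" "y $ i = x $ i" if "i \<in> J" for i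
      using that z_other[of i] assms[of i] by metis+
    then have "(\<Prod>i\<in>J. z $ i) = (\<Prod>i\<in>J. x $ i)" "(\<Prod>i\<in>J. y $ i) = (\<Prod>i\<in>J. x $ i)"
      by (auto intro!: prod.cong)
    then show ?thesis by (simp add: algebra_simps)
  qed
  show ?thesis
    unfolding z_def[symmetric]
    by (simp add: sym_multilinear_def prod_eq sum.distrib sum_distrib_left distrib_left mult.left_commute)
qed

text \<open>
  A coordinate strictly between \<open>l\<close> and \<open>u\<close> can be pushed to both ends; as \<open>m\<close> is affine along that
  segment, the graph point lies on the segment joining the two new graph points. Induction on the
  number of such coordinates ends at the vertices of the cube.
\<close>

lemma graph_point_in_hull_cube_graph:
  fixes x :: "real ^ 'n"
  assumes "l < u" and "x \<in> box_X l u"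
  shows "(x, sym_multilinear c x) \<in> convex hull (cube_graph c l u)"
  using assms(2)
proof (induction "card {j. x $ j \<noteq> l \<and> x $ j \<noteq> u}" arbitrary: x rule: less_induct)
  case less
  show ?case
  proof (cases "\<exists>j. x $ j \<noteq> l \<and> x $ j \<noteq> u")
    case False
    define A where "A = {j. x $ j = u}"
    have "x = two_valued l u A"
      using False by (auto simp: two_valued_def vec_eq_iff A_def)
    then have "(x, sym_multilinear c x) \<in> cube_graph c l u"
      by (auto simp: cube_graph_def)
    then show ?thesis by (rule hull_inc)
  next
    case True
    then obtain j where j: "x $ j \<noteq> l" "x $ j \<noteq> u" by blast
    define put where "put = (\<lambda>a. \<chi> i. if i = j then a else x $ i)"
    have hull: "(put a, sym_multilinear c (put a)) \<in> convex hull (cube_graph c l u)"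
      if "a = l \<or> a = u" for a
    proof (rule less.hyps)
      have "{i. put a $ i \<noteq> l \<and> put a $ i \<noteq> u} \<subset> {i. x $ i \<noteq> l \<and> x $ i \<noteq> u}"
        using that j by (auto simp: put_def split: if_splits)
      then show "card {i. put a $ i \<noteq> l \<and> put a $ i \<noteq> u} < card {i. x $ i \<noteq> l \<and> x $ i \<noteq> u}"
        by (simp add: psubset_card_mono)
      show "put a \<in> box_X l u"
        using that less.prems assms(1) by (auto simp: put_def box_X_def)
    qed
    define t where "t = (x $ j - l) / (u - l)"
    have t: "0 \<le> t" "t \<le> 1" "l + t * (u - l) = x $ j"
      using less.prems assms(1) by (auto simp: t_def box_X_def)
    have x_eq: "(1 - t) *\<^sub>R put l + t *\<^sub>R put u = x"
      using t(3) by (auto simp: vec_eq_iff put_def algebra_simps)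
    have "sym_multilinear c ((1 - t) *\<^sub>R put l + t *\<^sub>R put u)
        = (1 - t) * sym_multilinear c (put l) + t * sym_multilinear c (put u)"
      by (rule sym_multilinear_affine_coordinate[of j]) (simp add: put_def)
    then have pair_eq: "(x, sym_multilinear c x)
        = (1 - t) *\<^sub>R (put l, sym_multilinear c (put l)) + t *\<^sub>R (put u, sym_multilinear c (put u))"
      using x_eq by simp
    show ?thesis
      unfolding pair_eq using hull t(1,2) by (intro convexD_alt convex_convex_hull) auto
  qed
qed

lemma hull_graph_G_eq:
  assumes "l < u"
  shows "convex hull (graph_G c l u :: ((real ^ 'n) \<times> real) set) = convex hull (cube_graph c l u)"
proof (rule hull_unique)
  show "graph_G c l u \<subseteq> convex hull (cube_graph c l u)"
    using graph_point_in_hull_cube_graph[OF assms] by (auto simp: graph_G_def)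
  fix T :: "((real ^ 'n) \<times> real) set"
  assume T: "graph_G c l u \<subseteq> T" "convex T"
  have "cube_graph c l u \<subseteq> (graph_G c l u :: ((real ^ 'n) \<times> real) set)"
    using assms by (auto simp: cube_graph_def graph_G_def box_X_def two_valued_def)
  then show "convex hull (cube_graph c l u) \<subseteq> T"
    using T by (intro hull_minimal) auto
qed (rule convex_convex_hull)

lemma sym_multilinear_diagonal:
  "sym_multilinear c (\<chi> j::'n::finite. t) = (\<Sum>i = 2..CARD('n). c i * real (CARD('n) choose i) * t ^ i)"
proof -
  have "card {J. J \<subseteq> (UNIV::'n set) \<and> card J = i} = CARD('n) choose i" for i
    by (rule n_subsets) simp
  then show ?thesis by (simp add: sym_multilinear_def mult.assoc)
qed

text \<open>
  The relation is a polynomial identity in \<open>t\<close> on the infinite set \<open>[l, u]\<close>, so the coefficients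
  \<open>w * c i * (n choose i)\<close> of degree at least 2 must vanish, and one of them has \<open>c i \<noteq> 0\<close>.
\<close>

lemma sym_multilinear_diagonal_not_affine:
  assumes "l < u" and "\<exists>i\<in>{2..CARD('n::finite)}. c i \<noteq> 0"
    and "\<And>t. l \<le> t \<Longrightarrow> t \<le> u \<Longrightarrow> s * t + w * sym_multilinear c (\<chi> j::'n. t) = b"
  shows "w = 0"
proof (rule ccontr)
  assume "w \<noteq> 0"
  define P where "P = [:- b, s:] + (\<Sum>i = 2..CARD('n). monom (w * c i * real (CARD('n) choose i)) i)"
  have "poly P t = 0" if "t \<in> {l..u}" for t
    using assms(3)[of t] that
    by (simp add: P_def sym_multilinear_diagonal poly_sum poly_monom sum_distrib_left algebra_simps)
  then have "{l..u} \<subseteq> {t. poly P t = 0}" by blast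
  then have "P = 0"
    using infinite_Icc[OF assms(1)] finite_subset poly_roots_finite by blast
  obtain k where k: "k \<in> {2..CARD('n)}" "c k \<noteq> 0" using assms(2) by blast
  have "coeff [:- b, s:] k = 0"
    using k(1) by (intro coeff_eq_0) auto
  then have "coeff P k = w * c k * real (CARD('n) choose k)"
    using k(1) by (simp add: P_def coeff_sum)
  then show False
    using \<open>P = 0\<close> \<open>w \<noteq> 0\<close> k by simp
qed

text \<open>
  If \<open>G\<close> lay in a hyperplane with normal \<open>(a, w)\<close>, the diagonal would give \<open>w = 0\<close>, and comparing
  vertices of the cube that differ in a single coordinate would then give \<open>a = 0\<close>.
\<close>

lemma aff_dim_hull_graph_G:
  fixes c :: "nat \<Rightarrow> real"
  assumes "l < u" and "\<exists>i\<in>{2..CARD('n)}. c i \<noteq> 0"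
  shows "aff_dim (convex hull (graph_G c l u :: ((real ^ 'n) \<times> real) set)) = int (CARD('n)) + 1"
proof (rule ccontr)
  let ?G = "graph_G c l u :: ((real ^ 'n) \<times> real) set"
  assume "\<not> ?thesis"
  moreover have "aff_dim (convex hull ?G) \<le> int DIM((real ^ 'n) \<times> real)"
    by (rule aff_dim_le_DIM)
  ultimately have "aff_dim ?G < int DIM((real ^ 'n) \<times> real)"
    by (simp add: aff_dim_convex_hull)
  then obtain p b where p: "p \<noteq> 0" "?G \<subseteq> {z. p \<bullet> z = b}"
    by (rule aff_lowdim_subset_hyperplane)
  obtain a w where aw: "p = (a, w)" by fastforce
  have rel: "a \<bullet> x + w * sym_multilinear c x = b" if "x \<in> box_X l u" for x
    using p(2) that by (auto simp: aw graph_G_def inner_Pair)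
  have "(\<Sum>j\<in>UNIV. a $ j) * t + w * sym_multilinear c (\<chi> j::'n. t) = b" if "l \<le> t" "t \<le> u" for t
    using rel[of "\<chi> j. t"] that by (simp add: box_X_def inner_vec_def sum_distrib_right)
  then have "w = 0"
    using sym_multilinear_diagonal_not_affine[OF assms] by blast
  have "a $ j = 0" for j
  proof -
    have "two_valued l u A \<in> box_X l u" for A :: "'n set"
      using assms(1) by (simp add: two_valued_def box_X_def)
    then have "a \<bullet> two_valued l u {j} = a \<bullet> two_valued l u {}"
      using rel \<open>w = 0\<close> by simp
    then have "(u - l) * a $ j = 0"
      by (simp add: inner_vec_def sum_mult_two_valued)
    then show ?thesis using assms(1) by simp
  qed
  then have "a = 0" by (simp add: vec_eq_iff)
  then show False using p(1) aw \<open>w = 0\<close> by (simp add: zero_prod_def)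
qed

section \<open>Facets and vertical hyperplanes\<close>

lemma ineq_lhs_eq_0_hyperplane: "{p. ineq_lhs \<beta>0 \<beta> \<beta>' p = 0} = {p. (\<beta>, \<beta>') \<bullet> p = - \<beta>0}"
  by (auto simp: ineq_lhs_def inner_vec_def inner_Pair)

text \<open>
  The hyperplanes \<open>\<beta> x + \<beta>' y = - \<beta>0\<close> and \<open>a x = b\<close> are distinct, because on the former \<open>x\<close> is
  arbitrary; their intersection therefore has dimension at most \<open>n - 1\<close>.
\<close>

lemma aff_dim_in_vertical_hyperplane:
  fixes a \<beta> :: "real ^ 'n"
  assumes "\<beta>' \<noteq> 0" and "a \<noteq> 0"
    and "F \<subseteq> {p. ineq_lhs \<beta>0 \<beta> \<beta>' p = 0}" and "F \<subseteq> {p. a \<bullet> fst p = b}"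
  shows "aff_dim F < int (CARD('n))"
proof -
  let ?H = "{p. (\<beta>, \<beta>') \<bullet> p = - \<beta>0}" and ?K = "{p. (a, 0::real) \<bullet> p = b}"
  have "F \<subseteq> ?H \<inter> ?K"
    using assms(3,4) by (auto simp: ineq_lhs_eq_0_hyperplane inner_Pair)
  then have le: "aff_dim F \<le> aff_dim (?H \<inter> ?K)" by (rule aff_dim_subset)
  define x where "x = ((b + 1) / (a \<bullet> a)) *\<^sub>R a"
  have "a \<bullet> x = b + 1" using assms(2) by (simp add: x_def)
  moreover have "(x, (- \<beta>0 - \<beta> \<bullet> x) / \<beta>') \<in> ?H"
    using assms(1) by (simp add: inner_Pair)
  moreover have "(x, (- \<beta>0 - \<beta> \<bullet> x) / \<beta>') \<notin> ?K"
    using calculation(1) by (simp add: inner_Pair)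
  ultimately have "\<not> ?H \<subseteq> ?K" by blast
  moreover have "affine ?H" by (rule affine_hyperplane)
  moreover have "aff_dim ?H = int (CARD('n))"
    using assms(1) by (simp add: aff_dim_hyperplane zero_prod_def)
  ultimately have "aff_dim (?H \<inter> ?K) < int (CARD('n))"
    using aff_dim_affine_Int_hyperplane[of ?H "(a, 0)" b] by (auto split: if_splits)
  with le show ?thesis by simp
qed

text \<open>
  A face of a polytope is the convex hull of some of its generating points, so a linear equation that
  holds at all tight vertices holds on the whole facet. An equation \<open>a x = b\<close> in the \<open>x\<close>-coordinates
  alone would then make the dimension of the facet drop below \<open>n\<close>.
\<close>

lemma core_facet_vertices_not_vertical:
  fixes a \<beta> :: "real ^ 'n::{finite,linorder}"
  assumes "l < u" and "\<exists>i\<in>{2..CARD('n)}. c i \<noteq> 0"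
    and facet: "core_facet c l u \<beta>0 \<beta> \<beta>'" and "a \<noteq> 0"
  shows "\<exists>A. ineq_lhs \<beta>0 \<beta> \<beta>' (two_valued l u A, sym_multilinear c (two_valued l u A)) = 0 \<and>
           a \<bullet> two_valued l u A \<noteq> b"
proof (rule ccontr)
  assume "\<not> ?thesis"
  then have vertical: "a \<bullet> two_valued l u A = b"
    if "ineq_lhs \<beta>0 \<beta> \<beta>' (two_valued l u A, sym_multilinear c (two_valued l u A)) = 0" for A
    using that by blast
  define F where
    "F = {p \<in> convex hull (graph_G c l u :: ((real, 'n) vec \<times> real) set). ineq_lhs \<beta>0 \<beta> \<beta>' p = 0}"
  have F: "F facet_of (convex hull (graph_G c l u))" and "\<beta>' \<noteq> 0"
    using facet
    by (auto simp: core_facet_def valid_core_inequality_def core_inequality_def F_def)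
  then have "F face_of (convex hull (cube_graph c l u))"
    using hull_graph_G_eq[OF assms(1)] by (metis facet_of_imp_face_of)
  moreover have "compact (cube_graph c l u :: ((real, 'n) vec \<times> real) set)"
    by (simp add: cube_graph_def finite_imp_compact)
  ultimately obtain S where S: "S \<subseteq> cube_graph c l u" "F = convex hull S"
    by (metis face_of_convex_hull_subset)
  have "S \<subseteq> {p. (a, 0::real) \<bullet> p = b}"
  proof
    fix p assume "p \<in> S"
    then obtain A where p: "p = (two_valued l u A, sym_multilinear c (two_valued l u A))"
      using S(1) by (auto simp: cube_graph_def)
    have "p \<in> F" using \<open>p \<in> S\<close> S(2) by (simp add: hull_inc)
    then show "p \<in> {p. (a, 0::real) \<bullet> p = b}"
      using vertical[of A] by (simp add: p F_def inner_Pair)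
  qed
  then have "F \<subseteq> {p. (a, 0::real) \<bullet> p = b}"
    unfolding S(2) by (intro hull_minimal convex_hyperplane)
  then have "F \<subseteq> {p. a \<bullet> fst p = b}" by (auto simp: inner_Pair)
  then have "aff_dim F < int (CARD('n))"
    using \<open>\<beta>' \<noteq> 0\<close> \<open>a \<noteq> 0\<close> by (intro aff_dim_in_vertical_hyperplane) (auto simp: F_def)
  then show False
    using F aff_dim_hull_graph_G[where ?'n = 'n, OF assms(1,2)] by (simp add: facet_of_def)
qed

section \<open>Tight simplex vertices of a core facet\<close>

lemma exact_at_simplex_vertex_of_tight:
  fixes \<beta> :: "real ^ 'n::{finite,linorder}"
  assumes "l < u" and valid: "valid_core_inequality c l u \<beta>0 \<beta> \<beta>'"
    and tight: "ineq_lhs \<beta>0 \<beta> \<beta>' (two_valued l u A, sym_multilinear c (two_valued l u A)) = 0"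
  shows "exact_at_vertex c l u \<beta>0 \<beta> \<beta>' (card A)"
proof -
  let ?p = "let v = simplex_vertex l u (card A) in (v :: (real, 'n) vec, sym_multilinear c v)"
  have "ineq_lhs \<beta>0 \<beta> \<beta>' ?p \<le> 0"
    using ineq_lhs_simplex_vertex_le[of \<beta> \<beta>' l u \<beta>0 A c] assms
    by (simp add: valid_core_inequality_def)
  moreover have "?p \<in> graph_G c l u"
    using assms(1) by (simp add: Let_def graph_G_def box_X_def simplex_vertex_def)
  then have "0 \<le> ineq_lhs \<beta>0 \<beta> \<beta>' ?p"
    using valid hull_inc by (metis valid_core_inequality_def)
  ultimately show ?thesis by (simp add: exact_at_vertex_def)
qed

theorem proposition3p1:
  fixes c :: "nat \<Rightarrow> real" and l u \<beta>0 \<beta>' :: real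
    and \<beta> :: "real ^ 'n::{finite,linorder}"
  assumes "CARD('n) \<ge> 2"
    and "l < u"
    and "\<exists>i\<in>{2..CARD('n)}. c i \<noteq> 0"
    and "valid_core_inequality c l u \<beta>0 \<beta> \<beta>'"
    and "core_facet c l u \<beta>0 \<beta> \<beta>'"
  shows "\<exists>k\<in>{0..CARD('n)}. \<exists>k'\<in>{0..CARD('n)}. k \<noteq> k' \<and>
           exact_at_vertex c l u \<beta>0 \<beta> \<beta>' k \<and> exact_at_vertex c l u \<beta>0 \<beta> \<beta>' k' \<and>
           k \<noteq> 0 \<and> k \<noteq> CARD('n)"
proof -
  have card_le: "card A \<le> CARD('n)" for A :: "'n set"
    by (simp add: card_mono)
  note exact = exact_at_simplex_vertex_of_tight[OF assms(2,4)]
  note not_vertical = core_facet_vertices_not_vertical[OF assms(2,3,5)]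
  \<comment> \<open>Not all tight vertices are constant: otherwise \<open>x\<^sub>p - x\<^sub>q = 0\<close> would hold at all of them.\<close>
  obtain p q :: 'n where "p \<noteq> q"
    using assms(1) by (metis card_2_iff' ex_card)
  then have "axis p 1 - axis q (1::real) \<noteq> 0"
    by (auto simp: axis_eq_axis)
  then obtain A where A: "exact_at_vertex c l u \<beta>0 \<beta> \<beta>' (card A)"
      "(axis p 1 - axis q 1) \<bullet> two_valued l u A \<noteq> 0"
    using not_vertical[where b = 0] exact by metis
  have "A \<noteq> {}" "A \<noteq> UNIV"
    using A(2) by (auto simp: inner_diff_left inner_axis' two_valued_def)
  then have A_card: "card A \<noteq> 0" "card A \<noteq> CARD('n)"
    using card_subset_eq[of UNIV A] by auto
  \<comment> \<open>Not all tight vertices have \<open>card A\<close> entries \<open>u\<close>: the coordinate sum is not constant.\<close>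
  let ?one = "(\<chi> j. 1) :: (real, 'n) vec"
  have "?one \<noteq> 0" by (simp add: vec_eq_iff)
  then obtain B where B: "exact_at_vertex c l u \<beta>0 \<beta> \<beta>' (card B)"
      "?one \<bullet> two_valued l u B \<noteq> ?one \<bullet> two_valued l u A"
    using not_vertical[where b = "?one \<bullet> two_valued l u A"] exact by metis
  have "?one \<bullet> two_valued l u C = l * real CARD('n) + (u - l) * real (card C)" for C :: "'n set"
    using sum_mult_two_valued[where a = ?one and A = C] by (simp add: inner_vec_def)
  then have "card A \<noteq> card B" using B(2) by metis
  then show ?thesis
    using A(1) B(1) A_card card_le by (meson atLeastAtMost_iff le0)
qed

end
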